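(* Let $G$ be a group and let $\mathbf L$ be the lattice of subgroups of $G$. Let $\mathbf I$ and $\mathbf J$ be totally ordered sets, and let $H:\mathbf I\to\mathbf L$ and $N:\mathbf J\to\mathbf L$ be lattice homomorphisms (equivalently, order-preserving maps) such that $N_j$ is a normal subgroup of $G$ for every $j\in\mathbf J$. Then the set $\mathrm{Im}(H)\cup\mathrm{Im}(N)$ extends to a distributive sublattice of $\mathbf L$; that is, there is a distributive sublattice of $\mathbf L$ containing $\mathrm{Im}(H)\cup\mathrm{Im}(N)$. *)

theory Defs
  imports "HOL-Algebra.Generated_Groups"
begin

definition subgroup_lattice :: "('a, 'b) monoid_scheme \<Rightarrow> 'a set gorder"
  where "subgroup_lattice G = \<lparr>carrier = {H. subgroup H G}, eq = (=), le = (\<subseteq>)\<rparr>"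

definition lattice_hom :: "('a, 'c) gorder_scheme \<Rightarrow> ('b, 'd) gorder_scheme \<Rightarrow> ('a \<Rightarrow> 'b) \<Rightarrow> bool"
  where "lattice_hom X Y f \<longleftrightarrow>
    f \<in> carrier X \<rightarrow> carrier Y \<and> join_pres X Y f \<and> meet_pres X Y f"

definition sublattice :: "'a set \<Rightarrow> ('a, 'c) gorder_scheme \<Rightarrow> bool"
  where "sublattice S L \<longleftrightarrow>
    S \<subseteq> carrier L \<and> S \<noteq> {} \<and>
    (\<forall>x\<in>S. \<forall>y\<in>S. x \<squnion>\<^bsub>L\<^esub> y \<in> S \<and> x \<sqinter>\<^bsub>L\<^esub> y \<in> S)"

text \<open>Only one of the two dual distributive laws is required: in a lattice either implies
  the other.\<close>

definition distributive_sublattice :: "'a set \<Rightarrow> ('a, 'c) gorder_scheme \<Rightarrow> bool"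
  where "distributive_sublattice S L \<longleftrightarrow>
    sublattice S L \<and>
    (\<forall>x\<in>S. \<forall>y\<in>S. \<forall>z\<in>S. x \<sqinter>\<^bsub>L\<^esub> (y \<squnion>\<^bsub>L\<^esub> z) = (x \<sqinter>\<^bsub>L\<^esub> y) \<squnion>\<^bsub>L\<^esub> (x \<sqinter>\<^bsub>L\<^esub> z))"

lemma subgroup_lattice_sel [simp]:
  "carrier (subgroup_lattice G) = {H. subgroup H G}"
  "(.=\<^bsub>subgroup_lattice G\<^esub>) = (=)"
  "(\<sqsubseteq>\<^bsub>subgroup_lattice G\<^esub>) = (\<subseteq>)"
  by (simp_all add: subgroup_lattice_def)

lemma (in group) subgroup_lattice_is_lattice: "Lattice.lattice (subgroup_lattice G)"
  unfolding subgroup_lattice_def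
  by (rule complete_lattice_lattice) (rule subgroups_complete_lattice)

lemma (in group) subgroup_lattice_meet:
  assumes "subgroup A G" "subgroup B G"
  shows "A \<sqinter>\<^bsub>subgroup_lattice G\<^esub> B = A \<inter> B"
proof -
  interpret L: Lattice.lattice "subgroup_lattice G" by (rule subgroup_lattice_is_lattice)
  have AB: "A \<in> carrier (subgroup_lattice G)" "B \<in> carrier (subgroup_lattice G)"
    "A \<inter> B \<in> carrier (subgroup_lattice G)"
    using assms subgroups_Inter_pair by auto
  show ?thesis
    using L.meet_left[OF AB(1,2)] L.meet_right[OF AB(1,2)] L.meet_le[OF _ _ AB] by auto
qed

lemma (in group) subgroup_lattice_join:
  assumes "subgroup A G" "subgroup B G"
  shows "A \<squnion>\<^bsub>subgroup_lattice G\<^esub> B = generate G (A \<union> B)"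
proof -
  interpret L: Lattice.lattice "subgroup_lattice G" by (rule subgroup_lattice_is_lattice)
  have sub: "A \<union> B \<subseteq> carrier G" using assms subgroup.subset by blast
  have AB: "A \<in> carrier (subgroup_lattice G)" "B \<in> carrier (subgroup_lattice G)"
    "generate G (A \<union> B) \<in> carrier (subgroup_lattice G)"
    using assms generate_is_subgroup[OF sub] by auto
  have incl: "A \<union> B \<subseteq> generate G (A \<union> B)" by (auto intro: generate.incl)
  have "A \<squnion>\<^bsub>subgroup_lattice G\<^esub> B \<subseteq> generate G (A \<union> B)"
    using L.join_le[OF _ _ AB] incl by auto
  moreover have "generate G (A \<union> B) \<subseteq> A \<squnion>\<^bsub>subgroup_lattice G\<^esub> B"
    using L.join_left[OF AB(1,2)] L.join_right[OF AB(1,2)] L.join_closed[OF AB(1,2)]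
    by (intro generate_subgroup_incl) auto
  ultimately show ?thesis by blast
qed

lemma lattice_hom_iff_isotone:
  assumes "total_order X" and "Lattice.lattice Y"
  shows "lattice_hom X Y f \<longleftrightarrow> f \<in> carrier X \<rightarrow> carrier Y \<and> isotone X Y f"
proof
  assume "lattice_hom X Y f"
  then show "f \<in> carrier X \<rightarrow> carrier Y \<and> isotone X Y f"
    using join_pres_isotone by (auto simp: lattice_hom_def)
next
  interpret X: total_order X by fact
  interpret Y: Lattice.lattice Y by fact
  assume f: "f \<in> carrier X \<rightarrow> carrier Y \<and> isotone X Y f"
  have mono: "f x \<sqsubseteq>\<^bsub>Y\<^esub> f y" if "x \<in> carrier X" "y \<in> carrier X" "x \<sqsubseteq>\<^bsub>X\<^esub> y" for x y
    using f that by (auto simp: isotone_def)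
  have cl: "f x \<in> carrier Y" if "x \<in> carrier X" for x
    using f that by auto
  have le: "f (x \<squnion>\<^bsub>X\<^esub> y) = f x \<squnion>\<^bsub>Y\<^esub> f y \<and> f (x \<sqinter>\<^bsub>X\<^esub> y) = f x \<sqinter>\<^bsub>Y\<^esub> f y"
    if xy: "x \<in> carrier X" "y \<in> carrier X" and "x \<sqsubseteq>\<^bsub>X\<^esub> y" for x y
  proof -
    have "x \<squnion>\<^bsub>X\<^esub> y = y" "x \<sqinter>\<^bsub>X\<^esub> y = x"
      using that X.le_iff_join X.le_iff_meet by auto
    moreover have "f x \<squnion>\<^bsub>Y\<^esub> f y = f y" "f x \<sqinter>\<^bsub>Y\<^esub> f y = f x"
      using mono[OF that] cl[OF xy(1)] cl[OF xy(2)] Y.le_iff_join Y.le_iff_meet by auto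
    ultimately show ?thesis by simp
  qed
  have "f (x \<squnion>\<^bsub>X\<^esub> y) = f x \<squnion>\<^bsub>Y\<^esub> f y \<and> f (x \<sqinter>\<^bsub>X\<^esub> y) = f x \<sqinter>\<^bsub>Y\<^esub> f y"
    if xy: "x \<in> carrier X" "y \<in> carrier X" for x y
    using X.total_order_total[OF xy] le[OF xy] le[OF xy(2,1)]
    by (auto simp: join_comm[of X x y] join_comm[of Y "f x" "f y"]
        meet_comm[of X x y] meet_comm[of Y "f x" "f y"])
  then show "lattice_hom X Y f"
    using f X.lattice_axioms Y.lattice_axioms
    by (auto simp: lattice_hom_def join_pres_def meet_pres_def)
qed

end

theory Submission
  imports Defs "HOL-Algebra.Zassenhaus"
begin

text \<open>
  Adjoin the trivial subgroup and \<open>G\<close> to both chains, giving chains \<open>A\<close> (arbitrary subgroups)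
  and \<open>B\<close> (normal subgroups). For a finite \<open>P \<subseteq> A \<times> B\<close>, the join of the meets \<open>a' \<inter> b'\<close> with
  \<open>(a', b') \<in> P\<close> is also the intersection of those products \<open>a b\<close> that visibly contain every such
  meet, i.e. \<open>a' \<subseteq> a\<close> or \<open>b' \<subseteq> b\<close> for all \<open>(a', b') \<in> P\<close>. The first description is closed under
  joins; the second makes it closed under intersections, and shows that the intersection of the
  subgroups of \<open>P\<close> and \<open>Q\<close> is the one of the pairwise meets of \<open>P\<close> and \<open>Q\<close>. Distributivity is then
  inherited from the set-level identity between pairwise meets and unions.
\<close>

locale subgroup_chains = group G for G (structure) +
  fixes A B :: "'a set set"
  assumes sub_A: "a \<in> A \<Longrightarrow> subgroup a G"
    and chain_A: "\<lbrakk>a \<in> A; a' \<in> A\<rbrakk> \<Longrightarrow> a \<subseteq> a' \<or> a' \<subseteq> a"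
    and one_A: "{\<one>} \<in> A"
    and normal_B: "b \<in> B \<Longrightarrow> b \<lhd> G"
    and chain_B: "\<lbrakk>b \<in> B; b' \<in> B\<rbrakk> \<Longrightarrow> b \<subseteq> b' \<or> b' \<subseteq> b"
    and one_B: "{\<one>} \<in> B"
begin

section \<open>Joins of meets and the products that cover them\<close>

definition join_meets :: "('a set \<times> 'a set) set \<Rightarrow> 'a set"
  where "join_meets P = generate G (\<Union>(a, b)\<in>P. a \<inter> b)"

text \<open>The condition compares components instead of asking for
  \<open>a' \<inter> b' \<subseteq> a <#> b\<close>, so that \<open>covers_pair_meets\<close> needs
  only the order on the two chains.\<close>

definition covers :: "('a set \<times> 'a set) set \<Rightarrow> ('a set \<times> 'a set) set"
  where "covers P = {(a, b) \<in> A \<times> B. \<forall>(a', b')\<in>P. a' \<subseteq> a \<or> b' \<subseteq> b}"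

definition pair_meets ::
    "('a set \<times> 'a set) set \<Rightarrow> ('a set \<times> 'a set) set \<Rightarrow> ('a set \<times> 'a set) set"
  where "pair_meets P Q = (\<lambda>((a, b), (a', b')). (a \<inter> a', b \<inter> b')) ` (P \<times> Q)"

lemma sub_B: "b \<in> B \<Longrightarrow> subgroup b G"
  using normal_B normal_imp_subgroup by blast

lemma generators_carrier: "P \<subseteq> A \<times> B \<Longrightarrow> (\<Union>(a, b)\<in>P. a \<inter> b) \<subseteq> carrier G"
  using subgroup.subset[OF sub_A] by blast

lemma subgroup_join_meets: "P \<subseteq> A \<times> B \<Longrightarrow> subgroup (join_meets P) G"
  unfolding join_meets_def by (intro generate_is_subgroup generators_carrier)

lemma meet_subset_join_meets: "(a, b) \<in> P \<Longrightarrow> a \<inter> b \<subseteq> join_meets P"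
  unfolding join_meets_def by (auto intro: generate.incl)

lemma join_meets_least:
  assumes "subgroup K G" and "\<And>a b. (a, b) \<in> P \<Longrightarrow> a \<inter> b \<subseteq> K"
  shows "join_meets P \<subseteq> K"
  unfolding join_meets_def using assms by (intro generate_subgroup_incl) auto

lemma join_meets_mono: "Q \<subseteq> A \<times> B \<Longrightarrow> P \<subseteq> Q \<Longrightarrow> join_meets P \<subseteq> join_meets Q"
  by (intro join_meets_least subgroup_join_meets meet_subset_join_meets) auto

text \<open>Normality of \<open>b\<close> enters here: it lets \<open>a\<close> and \<open>b\<close>
  commute as sets.\<close>

lemma subgroup_set_mult: "a \<in> A \<Longrightarrow> b \<in> B \<Longrightarrow> subgroup (a <#> b) G"
  using mult_norm_subgroup[OF normal_B sub_A, of b a] commut_normal[OF sub_A normal_B, of a b] by simp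

lemma subset_set_mult:
  assumes "a \<in> A" "b \<in> B"
  shows "a \<subseteq> a <#> b" and "b \<subseteq> a <#> b"
proof -
  have a: "subgroup a G" and b: "subgroup b G" using assms sub_A sub_B by auto
  show "a \<subseteq> a <#> b"
  proof
    fix x assume "x \<in> a"
    then have "x = x \<otimes> \<one>" using subgroup.mem_carrier[OF a] by simp
    then show "x \<in> a <#> b"
      using \<open>x \<in> a\<close> subgroup.one_closed[OF b] unfolding set_mult_def by blast
  qed
  show "b \<subseteq> a <#> b"
  proof
    fix x assume "x \<in> b"
    then have "x = \<one> \<otimes> x" using subgroup.mem_carrier[OF b] by simp
    then show "x \<in> a <#> b"
      using \<open>x \<in> b\<close> subgroup.one_closed[OF a] unfolding set_mult_def by blast
  qed
qed

section \<open>Joins of meets as intersections of covering products\<close>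

lemma join_meets_subset_cover:
  assumes "(a, b) \<in> covers P"
  shows "join_meets P \<subseteq> a <#> b"
proof (rule join_meets_least)
  have ab: "a \<in> A" "b \<in> B" using assms by (auto simp: covers_def)
  show "subgroup (a <#> b) G" using ab by (rule subgroup_set_mult)
  show "a' \<inter> b' \<subseteq> a <#> b" if "(a', b') \<in> P" for a' b'
    using assms that subset_set_mult[OF ab] unfolding covers_def by blast
qed

lemma finite_chain_max:
  assumes "finite C" "C \<noteq> {}" "C \<subseteq> A"
  obtains m where "m \<in> C" "\<And>c. c \<in> C \<Longrightarrow> c \<subseteq> m"
proof -
  obtain m where m: "m \<in> C" "\<forall>c\<in>C. m \<subseteq> c \<longrightarrow> m = c"
    using finite_has_maximal[OF assms(1,2)] by blast
  have "c \<subseteq> m" if "c \<in> C" for c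
    using m chain_A[of c m] that assms(3) by blast
  then show thesis using that m(1) by blast
qed

text \<open>
  Split off the pair \<open>(a, b)\<close> of \<open>P\<close> with largest \<open>a\<close>. If \<open>m\<close> is the largest first component among
  the remaining pairs whose second component is not inside \<open>b\<close>, then \<open>(m, b)\<close> is a cover of \<open>P\<close>, so
  \<open>x = h k\<close> with \<open>h \<in> m\<close> and \<open>k \<in> a \<inter> b\<close>, and \<open>h\<close> lies in every cover of the remaining pairs.
\<close>

lemma covers_subset_join_meets:
  assumes "finite P" "P \<subseteq> A \<times> B" "\<And>a b. (a, b) \<in> covers P \<Longrightarrow> x \<in> a <#> b"
  shows "x \<in> join_meets P"
  using assms
proof (induction "card P" arbitrary: P x)
  case 0
  \<comment> \<open>Every pair covers the empty set, and the trivial one forces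
    \<open>x = \<one>\<close>.\<close>
  then have "({\<one>}, {\<one>}) \<in> covers P" using one_A one_B by (auto simp: covers_def)
  then have "x \<in> {\<one>} <#> {\<one>}" using 0 by blast
  then have "x = \<one>" by (auto simp: set_mult_def)
  then show ?case using subgroup.one_closed[OF subgroup_join_meets] 0 by blast
next
  case (Suc n)
  have "fst ` P \<noteq> {}" "finite (fst ` P)" "fst ` P \<subseteq> A" using Suc by auto
  then obtain a where a: "a \<in> fst ` P" "\<And>c. c \<in> fst ` P \<Longrightarrow> c \<subseteq> a"
    by (metis finite_chain_max)
  then obtain b where ab: "(a, b) \<in> P" by auto
  have aA: "a \<in> A" and bB: "b \<in> B" using ab Suc.prems by auto
  define P' where "P' = P - {(a, b)}"
  have P': "finite P'" "P' \<subseteq> A \<times> B" "P' \<subseteq> P" "n = card P'"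
    using Suc ab by (auto simp: P'_def)
  \<comment> \<open>The trivial subgroup is the default value of \<open>m\<close> when every
    remaining second component lies in \<open>b\<close>.\<close>
  define C where "C = insert {\<one>} (fst ` {(c, d) \<in> P'. \<not> d \<subseteq> b})"
  have "fst ` {(c, d) \<in> P'. \<not> d \<subseteq> b} \<subseteq> fst ` P'" by auto
  then have "finite C" "C \<noteq> {}" "C \<subseteq> A"
    unfolding C_def using P' one_A finite_subset[OF _ finite_imageI[OF P'(1)]] by auto
  then obtain m where m: "m \<in> C" "\<And>c. c \<in> C \<Longrightarrow> c \<subseteq> m"
    by (metis finite_chain_max)
  have mA: "m \<in> A" using m(1) \<open>C \<subseteq> A\<close> by blast
  have ma: "m \<subseteq> a"
    using m(1) a(2) P'(3) subgroup.one_closed[OF sub_A[OF aA]] unfolding C_def by force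
  have "(m, b) \<in> covers P"
  proof -
    have "c \<subseteq> m \<or> d \<subseteq> b" if "(c, d) \<in> P" for c d
    proof (cases "d \<subseteq> b")
      case False
      then have "c \<in> C" using that unfolding C_def P'_def by (force intro: image_eqI)
      then show ?thesis using m(2) by blast
    qed simp
    then show ?thesis using mA bB by (auto simp: covers_def)
  qed
  then obtain h k where hk: "h \<in> m" "k \<in> b" "x = h \<otimes> k"
    using Suc.prems(3) unfolding set_mult_def by blast
  \<comment> \<open>This cover exists because \<open>a\<close> is the largest first component. It
    puts \<open>x\<close> in \<open>a\<close>, and since \<open>h \<in> m \<subseteq> a\<close>,
    also \<open>k\<close>.\<close>
  have "(a, {\<one>}) \<in> covers P"
    using aA one_B a(2) unfolding covers_def by force
  then have "x \<in> a <#> {\<one>}" using Suc.prems(3) by blast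
  then have xa: "x \<in> a"
    using subgroup.mem_carrier[OF sub_A[OF aA]] by (auto simp: set_mult_def)
  have car: "h \<in> carrier G" "k \<in> carrier G"
    using hk subgroup.mem_carrier sub_A[OF mA] sub_B[OF bB] by metis+
  have "k = inv h \<otimes> x" using hk(3) car by (simp add: m_assoc[symmetric])
  then have ka: "k \<in> a"
    using xa hk(1) ma sub_A[OF aA]
    by (auto intro: subgroup.m_closed subgroup.m_inv_closed)
  have "h \<in> c <#> d" if cd: "(c, d) \<in> covers P'" for c d
  proof (cases "m \<subseteq> c")
    case True
    then show ?thesis using cd hk(1) subset_set_mult[of c d] by (auto simp: covers_def)
  next
    case False
    have cA: "c \<in> A" and dB: "d \<in> B" using cd by (auto simp: covers_def)
    \<comment> \<open>So \<open>m\<close> is not the default but comes from a pair of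
      \<open>P'\<close>. Covering that pair without \<open>m \<subseteq> c\<close> makes
      \<open>d\<close> so large that it contains \<open>b\<close>, hence \<open>(c, d)\<close>
      covers the removed pair as well.\<close>
    have "m \<noteq> {\<one>}" using False subgroup.one_closed[OF sub_A[OF cA]] by auto
    then obtain e where e: "(m, e) \<in> P'" "\<not> e \<subseteq> b" 
      using m(1) unfolding C_def by fastforce
    have "e \<subseteq> d" using e(1) False cd by (auto simp: covers_def)
    then have bd: "b \<subseteq> d" using chain_B[OF bB dB] e(2) by blast
    then have "(c, d) \<in> covers P" using cd unfolding covers_def P'_def by blast
    then have "x \<in> c <#> d" by (rule Suc.prems(3))
    moreover have "k \<in> c <#> d" using hk(2) bd subset_set_mult(2)[OF cA dB] by blast
    moreover have "h = x \<otimes> inv k" using hk(3) car by (simp add: m_assoc)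
    ultimately show ?thesis
      using subgroup_set_mult[OF cA dB]
      by (auto intro: subgroup.m_closed subgroup.m_inv_closed)
  qed
  then have "h \<in> join_meets P'" using Suc.hyps(1)[OF P'(4,1,2)] by blast
  then have "h \<in> join_meets P" using join_meets_mono[OF Suc.prems(2) P'(3)] by blast
  moreover have "k \<in> join_meets P" using hk(2) ka meet_subset_join_meets[OF ab] by blast
  ultimately show ?case
    using hk(3) subgroup.m_closed[OF subgroup_join_meets[OF Suc.prems(2)]] by simp
qed

section \<open>Closure under meets and joins, and distributivity\<close>

lemma pair_meets_closed:
  assumes "P \<subseteq> A \<times> B" "Q \<subseteq> A \<times> B"
  shows "pair_meets P Q \<subseteq> A \<times> B"
proof -
  have "a \<inter> a' \<in> A" if "a \<in> A" "a' \<in> A" for a a'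
    using chain_A[OF that] that by (auto simp: Int_absorb1 Int_absorb2)
  moreover have "b \<inter> b' \<in> B" if "b \<in> B" "b' \<in> B" for b b'
    using chain_B[OF that] that by (auto simp: Int_absorb1 Int_absorb2)
  ultimately show ?thesis using assms unfolding pair_meets_def by fastforce
qed

lemma finite_pair_meets: "finite P \<Longrightarrow> finite Q \<Longrightarrow> finite (pair_meets P Q)"
  by (simp add: pair_meets_def)

text \<open>In a chain the intersection of two members is one of them. If \<open>(a, b)\<close>
  misses a pair of \<open>P\<close> and a pair of \<open>Q\<close>, neither component of their meet
  lies in \<open>a\<close> or \<open>b\<close> respectively, so \<open>(a, b)\<close> misses that
  meet too.\<close>

lemma covers_pair_meets:
  assumes "P \<subseteq> A \<times> B" "Q \<subseteq> A \<times> B"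
  shows "covers (pair_meets P Q) \<subseteq> covers P \<union> covers Q"
proof (rule subsetI, rule ccontr)
  fix z assume z: "z \<in> covers (pair_meets P Q)" "z \<notin> covers P \<union> covers Q"
  obtain a b where ab: "z = (a, b)" "a \<in> A" "b \<in> B" using z by (auto simp: covers_def)
  obtain a1 b1 where 1: "(a1, b1) \<in> P" "\<not> a1 \<subseteq> a" "\<not> b1 \<subseteq> b"
    using z(2) ab by (auto simp: covers_def)
  obtain a2 b2 where 2: "(a2, b2) \<in> Q" "\<not> a2 \<subseteq> a" "\<not> b2 \<subseteq> b"
    using z(2) ab by (auto simp: covers_def)
  have "(a1 \<inter> a2, b1 \<inter> b2) \<in> pair_meets P Q"
    using 1(1) 2(1) unfolding pair_meets_def by force
  then have "a1 \<inter> a2 \<subseteq> a \<or> b1 \<inter> b2 \<subseteq> b"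
    using z(1) ab by (auto simp: covers_def)
  moreover have "a1 \<subseteq> a2 \<or> a2 \<subseteq> a1" "b1 \<subseteq> b2 \<or> b2 \<subseteq> b1"
    using 1(1) 2(1) assms by (meson chain_A chain_B mem_Sigma_iff subsetD)+
  ultimately show False using 1 2 by blast
qed

lemma join_meets_Int:
  assumes "finite P" "P \<subseteq> A \<times> B" "finite Q" "Q \<subseteq> A \<times> B"
  shows "join_meets P \<inter> join_meets Q = join_meets (pair_meets P Q)"
proof (rule subset_antisym)
  show "join_meets P \<inter> join_meets Q \<subseteq> join_meets (pair_meets P Q)"
  proof
    fix x assume x: "x \<in> join_meets P \<inter> join_meets Q"
    show "x \<in> join_meets (pair_meets P Q)"
    proof (rule covers_subset_join_meets)
      \<comment> \<open>The pair covers \<open>P\<close> or \<open>Q\<close>, and \<open>x\<close>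
        lies in both joins.\<close>
      show "x \<in> a <#> b" if "(a, b) \<in> covers (pair_meets P Q)" for a b
        using that covers_pair_meets[OF assms(2,4)] join_meets_subset_cover x by blast
    qed (use assms finite_pair_meets pair_meets_closed in auto)
  qed
  have "c \<inter> d \<subseteq> join_meets P \<inter> join_meets Q" if "(c, d) \<in> pair_meets P Q" for c d
  proof -
    obtain z where z: "z \<in> P \<times> Q" "(c, d) = (\<lambda>((a, b), (a', b')). (a \<inter> a', b \<inter> b')) z"
      using \<open>(c, d) \<in> pair_meets P Q\<close> unfolding pair_meets_def by (elim imageE)
    obtain a b a' b' where "z = ((a, b), (a', b'))" by (metis surj_pair)
    then have p: "(a, b) \<in> P" "(a', b') \<in> Q" "(c, d) = (a \<inter> a', b \<inter> b')"
      using z by auto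
    show ?thesis
      using p meet_subset_join_meets[of a b P] meet_subset_join_meets[of a' b' Q] by blast
  qed
  then show "join_meets (pair_meets P Q) \<subseteq> join_meets P \<inter> join_meets Q"
    using assms by (intro join_meets_least subgroups_Inter_pair subgroup_join_meets) auto
qed

lemma join_meets_join:
  assumes "P \<subseteq> A \<times> B" "Q \<subseteq> A \<times> B"
  shows "join_meets P \<squnion>\<^bsub>subgroup_lattice G\<^esub> join_meets Q = join_meets (P \<union> Q)"
proof -
  have sub: "subgroup (join_meets P) G" "subgroup (join_meets Q) G"
    using assms subgroup_join_meets by auto
  have PQ: "P \<union> Q \<subseteq> A \<times> B" using assms by auto
  have "join_meets P \<union> join_meets Q \<subseteq> carrier G" using sub subgroup.subset by blast
  then have "subgroup (generate G (join_meets P \<union> join_meets Q)) G"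
    by (rule generate_is_subgroup)
  moreover have "join_meets P \<union> join_meets Q \<subseteq> generate G (join_meets P \<union> join_meets Q)"
    by (auto intro: generate.incl)
  ultimately have "join_meets (P \<union> Q) \<subseteq> generate G (join_meets P \<union> join_meets Q)"
    using meet_subset_join_meets by (intro join_meets_least) blast+
  moreover have "generate G (join_meets P \<union> join_meets Q) \<subseteq> join_meets (P \<union> Q)"
    using join_meets_mono[OF PQ] subgroup_join_meets[OF PQ]
    by (intro generate_subgroup_incl) auto
  ultimately show ?thesis using subgroup_lattice_join[OF sub] by blast
qed

lemma join_meets_meet:
  assumes "finite P" "P \<subseteq> A \<times> B" "finite Q" "Q \<subseteq> A \<times> B"
  shows "join_meets P \<sqinter>\<^bsub>subgroup_lattice G\<^esub> join_meets Q = join_meets (pair_meets P Q)"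
  using assms by (simp add: subgroup_lattice_meet subgroup_join_meets join_meets_Int)

lemma distributive_sublattice_join_meets:
  "distributive_sublattice (join_meets ` {P. finite P \<and> P \<subseteq> A \<times> B}) (subgroup_lattice G)"
proof -
  \<comment> \<open>Applying \<open>join_meets\<close> to both sides gives the distributive
    law.\<close>
  have "pair_meets P (Q \<union> R) = pair_meets P Q \<union> pair_meets P R" for P Q R
    unfolding pair_meets_def by blast
  then show ?thesis
    unfolding distributive_sublattice_def sublattice_def
    using finite_pair_meets pair_meets_closed
    by (auto simp: join_meets_join join_meets_meet subgroup_join_meets intro!: imageI)
qed

lemma join_meets_singleton:
  assumes "a \<in> A" "b \<in> B"
  shows "join_meets {(a, b)} = a \<inter> b"
proof (rule subset_antisym)
  show "join_meets {(a, b)} \<subseteq> a \<inter> b"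
    using assms by (intro join_meets_least subgroups_Inter_pair sub_A sub_B) auto
qed (simp add: meet_subset_join_meets)

end

section \<open>Application to the images of the two homomorphisms\<close>

theorem theorem65:
  fixes G :: "('a, 'b) monoid_scheme"
    and I :: "'i gorder" and J :: "'j gorder"
    and H :: "'i \<Rightarrow> 'a set" and N :: "'j \<Rightarrow> 'a set"
  assumes "group G"
    and "total_order I" and "total_order J"
    and "lattice_hom I (subgroup_lattice G) H"
    and "lattice_hom J (subgroup_lattice G) N"
    and "\<And>j. j \<in> carrier J \<Longrightarrow> N j \<lhd> G"
  shows "\<exists>S. distributive_sublattice S (subgroup_lattice G) \<and>
             H ` carrier I \<union> N ` carrier J \<subseteq> S"
proof -
  interpret group G by fact
  have chain: "f x \<subseteq> f y \<or> f y \<subseteq> f x"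
    if "total_order X" "lattice_hom X (subgroup_lattice G) f" "x \<in> carrier X" "y \<in> carrier X"
    for X :: "'k gorder" and f x y
  proof -
    have "isotone X (subgroup_lattice G) f"
      using lattice_hom_iff_isotone[OF that(1) subgroup_lattice_is_lattice] that(2) by blast
    then show ?thesis
      using total_order.total_order_total[OF that(1,3,4)] that(3,4)
      by (simp add: isotone_def) blast
  qed
  have H: "subgroup (H i) G" if "i \<in> carrier I" for i
    using assms(4) that by (auto simp: lattice_hom_def)
  \<comment> \<open>With \<open>carrier G\<close> in both chains, each \<open>H i\<close> and each
    \<open>N j\<close> is itself a meet of a member of \<open>A\<close> with a member of
    \<open>B\<close>.\<close>
  define A where "A = insert {\<one>\<^bsub>G\<^esub>} (insert (carrier G) (H ` carrier I))"
  define B where "B = insert {\<one>\<^bsub>G\<^esub>} (insert (carrier G) (N ` carrier J))"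
  have sub: "subgroup a G" if "a \<in> A" for a
    using that H triv_subgroup subgroup_self by (auto simp: A_def)
  have nrm: "b \<lhd> G" if "b \<in> B" for b
    using that assms(6) one_is_normal subgroup_self by (auto simp: B_def normal_inv_iff)
  \<comment> \<open>The adjoined subgroups are thus comparable with all others, so \<open>A\<close>
    and \<open>B\<close> are still chains.\<close>
  have bounds: "\<one>\<^bsub>G\<^esub> \<in> K \<and> K \<subseteq> carrier G" if "K \<in> A \<or> K \<in> B" for K
    using that sub nrm normal_imp_subgroup subgroup.one_closed subgroup.subset by metis
  interpret subgroup_chains G A B
  proof (rule subgroup_chains.intro[OF assms(1)], rule subgroup_chains_axioms.intro)
    show "a \<subseteq> a' \<or> a' \<subseteq> a" if "a \<in> A" "a' \<in> A" for a a'
      using that bounds[of a] bounds[of a'] chain[OF assms(2,4)] by (auto simp: A_def)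
    show "b \<subseteq> b' \<or> b' \<subseteq> b" if "b \<in> B" "b' \<in> B" for b b'
      using that bounds[of b] bounds[of b'] chain[OF assms(3,5)] by (auto simp: B_def)
    show "{\<one>\<^bsub>G\<^esub>} \<in> A" "{\<one>\<^bsub>G\<^esub>} \<in> B"
      by (simp_all add: A_def B_def)
  qed (rule sub nrm; assumption)+
  let ?S = "join_meets ` {P. finite P \<and> P \<subseteq> A \<times> B}"
  have meets: "a \<inter> b \<in> ?S" if "a \<in> A" "b \<in> B" for a b
    using join_meets_singleton[OF that] that by (intro image_eqI[of _ _ "{(a, b)}"]) auto
  have "H i \<in> ?S" if "i \<in> carrier I" for i
    using meets[of "H i" "carrier G"] that bounds[of "H i"]
    by (simp add: A_def B_def Int_absorb2)
  moreover have "N j \<in> ?S" if "j \<in> carrier J" for j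
    using meets[of "carrier G" "N j"] that bounds[of "N j"]
    by (simp add: A_def B_def Int_absorb1)
  ultimately show ?thesis using distributive_sublattice_join_meets by blast
qed

end
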